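(* Let $\mathcal{I}$ be a nontrivial admissible ideal on $\mathbb{N}$ satisfying shrinking condition (C). Let $X$ and $Y$ be topological spaces that are $\mathcal{I}$-sequential and $\mathcal{I}$-US, let $X$ be $T_1$, and let $f:X\to Y$ be continuous. Let $\widehat{X}=X\cup\{\alpha_x\}$ and $\widehat{Y}=Y\cup\{\alpha_y\}$ be the one point $\mathcal{I}$-compactifications of $X$ and $Y$, and let $\widehat{f}:\widehat{X}\to\widehat{Y}$ be the extension of $f$ with $\widehat{f}(\alpha_x)=\alpha_y$. Then $\widehat{f}$ is continuous if and only if $f$ is $\mathcal{I}$-proper.
   Context: An ideal $\mathcal{I}$ on $\mathbb{N}$ is a family of subsets of $\mathbb{N}$ containing $\emptyset$ and closed under finite unions and subsets; it is nontrivial if $\mathcal{I}\neq\{\emptyset\}$ and $\mathbb{N}\notin\mathcal{I}$, and a nontrivial ideal is admissible if it contains all singletons. For $M\subset\mathbb{N}$, $\mathcal{I}/_M=\{A\cap M: A\in\mathcal{I}\}$. A sequence $(x_n)_{n\in M}$ in a topological space (a family indexed by $M\subset\mathbb{N}$) is $\mathcal{I}$-nonthin if $M\notin\mathcal{I}$. It $\mathcal{I}/_M$-converges to $x$ if for every open set $U\ni x$, $\{n\in M: x_n\notin U\}\in\mathcal{I}/_M$; $x$ is then called an $\mathcal{I}$-limit. Subsequences of $(x_n)_{n\in K}$ are the families $(x_n)_{n\in M}$ with $M\subset K$. A space $X$ is $\mathcal{I}$-compact if every $\mathcal{I}$-nonthin sequence $(x_n)_{n\in K}$ in $X$ has an $\mathcal{I}$-nonthin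 subsequence $(x_n)_{n\in M}$ that $\mathcal{I}/_M$-converges to some point of $X$; a subset is $\mathcal{I}$-compact if it is so as a subspace. A subset $A\subset X$ is $\mathcal{I}$-closed if $A$ equals the set of all $x\in X$ for which there is an $\mathcal{I}$-nonthin sequence $(x_n)_{n\in L}$ in $A$ that $\mathcal{I}/_L$-converges to $x$. A space is $\mathcal{I}$-sequential if every $\mathcal{I}$-closed set is closed. A space is $\mathcal{I}$-US if every $\mathcal{I}$-nonthin $\mathcal{I}/_M$-convergent sequence $(x_n)_{n\in M}$ has exactly one $\mathcal{I}$-limit. A function $f:X\to Y$ is $\mathcal{I}$-continuous if whenever an $\mathcal{I}$-nonthin sequence $(x_n)_{n\in M}$ $\mathcal{I}/_M$-converges to $x$, $(f(x_n))_{n\in M}$ $\mathcal{I}/_M$-converges to $f(x)$. It is $\mathcal{I}$-closed if the image of every $\mathcal{I}$-closed set is $\mathcal{I}$-closed. It is $\mathcal{I}$-proper if it is $\mathcal{I}$-continuous and $f\times 1_Z: X\times Z\to Y\times Z$ is $\mathcal{I}$-closed for every topological space $Z$. $\mathcal{I}$ satisfies shrinking condition (C) if for every $A\notin\mathcal{I}$ there is $B\subset A$ with $B\notin\mathcal{I}$ such that no infinite subset of $B$ is in $\mathcal{I}$. The one point $\mathcal{I}$-compactification of a space $(X,\tau)$ is the set $\widehat{X}=X\cup\{\alpha\}$, where $\alpha\notin X$ is the point at infinity of $X$, with topology $\widehat{\tau}=\tau\cup\{U\cup\{\alpha\}: U\subset X,\ X-U \text{ is closed and } \mathcal{I}\text{-compact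 in } X\}$. *)

theory Defs
  imports "HOL-Analysis.Analysis"
begin

definition nat_ideal :: "nat set set \<Rightarrow> bool" where
  "nat_ideal \<I> \<longleftrightarrow> {} \<in> \<I> \<and> (\<forall>A\<in>\<I>. \<forall>B\<in>\<I>. A \<union> B \<in> \<I>) \<and> (\<forall>A\<in>\<I>. \<forall>B. B \<subseteq> A \<longrightarrow> B \<in> \<I>)"

definition nontrivial_ideal :: "nat set set \<Rightarrow> bool" where
  "nontrivial_ideal \<I> \<longleftrightarrow> nat_ideal \<I> \<and> \<I> \<noteq> {{}} \<and> UNIV \<notin> \<I>"

definition admissible_ideal :: "nat set set \<Rightarrow> bool" where
  "admissible_ideal \<I> \<longleftrightarrow> nontrivial_ideal \<I> \<and> (\<forall>n. {n} \<in> \<I>)"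

definition trace_ideal :: "nat set set \<Rightarrow> nat set \<Rightarrow> nat set set" where
  "trace_ideal \<I> M = {A \<inter> M |A. A \<in> \<I>}"

definition shrinking_C :: "nat set set \<Rightarrow> bool" where
  "shrinking_C \<I> \<longleftrightarrow>
     (\<forall>A. A \<notin> \<I> \<longrightarrow> (\<exists>B\<subseteq>A. B \<notin> \<I> \<and> (\<forall>C\<subseteq>B. infinite C \<longrightarrow> C \<notin> \<I>)))"

text \<open>
  A sequence \<open>(x\<^sub>n)\<close> indexed by \<open>n \<in> M\<close> in the space \<open>X\<close> is a total function \<open>x\<close> together with its
  index set \<open>M\<close>, where \<open>x ` M \<subseteq> topspace X\<close>; the values of \<open>x\<close> off \<open>M\<close> play no role. It is nonthin
  if \<open>M \<notin> \<I>\<close>, and its subsequences are the pairs \<open>x\<close>, \<open>M'\<close> with \<open>M' \<subseteq> M\<close>.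
\<close>

definition I_limitin ::
    "nat set set \<Rightarrow> 'a topology \<Rightarrow> nat set \<Rightarrow> (nat \<Rightarrow> 'a) \<Rightarrow> 'a \<Rightarrow> bool" where
  "I_limitin \<I> X M x l \<longleftrightarrow>
     x ` M \<subseteq> topspace X \<and> l \<in> topspace X \<and>
     (\<forall>U. openin X U \<and> l \<in> U \<longrightarrow> {n \<in> M. x n \<notin> U} \<in> trace_ideal \<I> M)"

definition I_compact_space :: "nat set set \<Rightarrow> 'a topology \<Rightarrow> bool" where
  "I_compact_space \<I> X \<longleftrightarrow>
     (\<forall>K x. K \<notin> \<I> \<and> x ` K \<subseteq> topspace X \<longrightarrow>
        (\<exists>M\<subseteq>K. M \<notin> \<I> \<and> (\<exists>l. I_limitin \<I> X M x l)))"

definition I_compactin :: "nat set set \<Rightarrow> 'a topology \<Rightarrow> 'a set \<Rightarrow> bool" where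
  "I_compactin \<I> X S \<longleftrightarrow> S \<subseteq> topspace X \<and> I_compact_space \<I> (subtopology X S)"

definition I_closedin :: "nat set set \<Rightarrow> 'a topology \<Rightarrow> 'a set \<Rightarrow> bool" where
  "I_closedin \<I> X A \<longleftrightarrow>
     A \<subseteq> topspace X \<and>
     A = {l \<in> topspace X. \<exists>L x. L \<notin> \<I> \<and> x ` L \<subseteq> A \<and> I_limitin \<I> X L x l}"

definition I_sequential :: "nat set set \<Rightarrow> 'a topology \<Rightarrow> bool" where
  "I_sequential \<I> X \<longleftrightarrow> (\<forall>A. I_closedin \<I> X A \<longrightarrow> closedin X A)"

definition I_US :: "nat set set \<Rightarrow> 'a topology \<Rightarrow> bool" where
  "I_US \<I> X \<longleftrightarrow>
     (\<forall>M x. M \<notin> \<I> \<and> (\<exists>l. I_limitin \<I> X M x l) \<longrightarrow> (\<exists>!l. I_limitin \<I> X M x l))"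

definition I_continuous_map ::
    "nat set set \<Rightarrow> 'a topology \<Rightarrow> 'b topology \<Rightarrow> ('a \<Rightarrow> 'b) \<Rightarrow> bool" where
  "I_continuous_map \<I> X Y f \<longleftrightarrow>
     f ` topspace X \<subseteq> topspace Y \<and>
     (\<forall>M x l. M \<notin> \<I> \<and> I_limitin \<I> X M x l \<longrightarrow> I_limitin \<I> Y M (\<lambda>n. f (x n)) (f l))"

definition I_closed_map ::
    "nat set set \<Rightarrow> 'a topology \<Rightarrow> 'b topology \<Rightarrow> ('a \<Rightarrow> 'b) \<Rightarrow> bool" where
  "I_closed_map \<I> X Y f \<longleftrightarrow>
     f ` topspace X \<subseteq> topspace Y \<and> (\<forall>A. I_closedin \<I> X A \<longrightarrow> I_closedin \<I> Y (f ` A))"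

text \<open>
  A formula of HOL cannot quantify over all types, so the test spaces \<open>Z\<close> range over all
  topologies (with arbitrary carrier) on one type \<open>'z\<close>, which is a parameter. Lemma
  \<open>I_proper_map_transfer\<close> below shows that being \<open>\<I>\<close>-proper with respect to any one infinite type
  entails it with respect to every type, so that for infinite \<open>'z\<close> nothing is lost.
\<close>

definition I_proper_map ::
    "'z itself \<Rightarrow> nat set set \<Rightarrow> 'a topology \<Rightarrow> 'b topology \<Rightarrow> ('a \<Rightarrow> 'b) \<Rightarrow> bool" where
  "I_proper_map (_ :: 'z itself) \<I> X Y f \<longleftrightarrow>
     I_continuous_map \<I> X Y f \<and>
     (\<forall>Z :: 'z topology.
        I_closed_map \<I> (prod_topology X Z) (prod_topology Y Z) (\<lambda>(x, z). (f x, z)))"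

text \<open>The point at infinity is \<^const>\<open>None\<close>, and \<open>X\<close> is embedded by \<^const>\<open>Some\<close>.\<close>

definition I_compactification_open :: "nat set set \<Rightarrow> 'a topology \<Rightarrow> 'a option set \<Rightarrow> bool" where
  "I_compactification_open \<I> X W \<longleftrightarrow>
     (\<exists>U. openin X U \<and> W = Some ` U) \<or>
     (\<exists>U\<subseteq>topspace X. closedin X (topspace X - U) \<and> I_compactin \<I> X (topspace X - U) \<and>
        W = insert None (Some ` U))"

definition I_compactification :: "nat set set \<Rightarrow> 'a topology \<Rightarrow> 'a option topology" where
  "I_compactification \<I> X = topology (I_compactification_open \<I> X)"

lemma trace_ideal_iff:
  assumes "nat_ideal \<I>" "A \<subseteq> M"
  shows "A \<in> trace_ideal \<I> M \<longleftrightarrow> A \<in> \<I>"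
proof
  assume "A \<in> trace_ideal \<I> M"
  then obtain B where "B \<in> \<I>" "A = B \<inter> M" by (auto simp: trace_ideal_def)
  then show "A \<in> \<I>" using assms(1) unfolding nat_ideal_def by (metis inf_le1)
next
  assume "A \<in> \<I>"
  moreover have "A = A \<inter> M" using assms(2) by blast
  ultimately show "A \<in> trace_ideal \<I> M" unfolding trace_ideal_def by blast
qed

lemma I_limitin_iff:
  assumes "nat_ideal \<I>"
  shows "I_limitin \<I> X M x l \<longleftrightarrow>
     x ` M \<subseteq> topspace X \<and> l \<in> topspace X \<and>
     (\<forall>U. openin X U \<and> l \<in> U \<longrightarrow> {n \<in> M. x n \<notin> U} \<in> \<I>)"
proof -
  have "{n \<in> M. x n \<notin> U} \<in> trace_ideal \<I> M \<longleftrightarrow> {n \<in> M. x n \<notin> U} \<in> \<I>" for U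
    by (rule trace_ideal_iff[OF assms]) blast
  then show ?thesis unfolding I_limitin_def by simp
qed

lemma I_limitin_subtopology:
  assumes I: "nat_ideal \<I>"
  shows "I_limitin \<I> (subtopology X S) M x l \<longleftrightarrow> x ` M \<subseteq> S \<and> l \<in> S \<and> I_limitin \<I> X M x l"
proof (cases "x ` M \<subseteq> S \<and> l \<in> S")
  case True
  then have eq: "{n \<in> M. x n \<notin> T \<inter> S} = {n \<in> M. x n \<notin> T}" for T by auto
  have "(\<forall>U. openin (subtopology X S) U \<and> l \<in> U \<longrightarrow> {n \<in> M. x n \<notin> U} \<in> \<I>) \<longleftrightarrow>
        (\<forall>T. openin X T \<and> l \<in> T \<inter> S \<longrightarrow> {n \<in> M. x n \<notin> T \<inter> S} \<in> \<I>)"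
    unfolding openin_subtopology by blast
  with True show ?thesis unfolding I_limitin_iff[OF I] eq by auto
next
  case False
  then show ?thesis unfolding I_limitin_iff[OF I] by auto
qed

lemma I_compactin_closed_subset:
  assumes I: "nat_ideal \<I>" and S: "I_compactin \<I> X S" and T: "closedin X T" "T \<subseteq> S"
  shows "I_compactin \<I> X T"
  unfolding I_compactin_def I_compact_space_def
proof (intro conjI allI impI)
  show Ts: "T \<subseteq> topspace X" using T closedin_subset by blast
  fix K and x :: "nat \<Rightarrow> 'a"
  assume "K \<notin> \<I> \<and> x ` K \<subseteq> topspace (subtopology X T)"
  then have K: "K \<notin> \<I>" "x ` K \<subseteq> T" by auto
  with S T Ts have "x ` K \<subseteq> topspace (subtopology X S)" by auto
  with S K obtain M l where M: "M \<subseteq> K" "M \<notin> \<I>" "I_limitin \<I> (subtopology X S) M x l"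
    unfolding I_compactin_def I_compact_space_def by meson
  then have l: "I_limitin \<I> X M x l" by (simp add: I_limitin_subtopology[OF I])
  have "l \<in> T"
  proof (rule ccontr)
    assume "l \<notin> T"
    with l T have "{n \<in> M. x n \<notin> topspace X - T} \<in> \<I>"
      unfolding I_limitin_iff[OF I] by (auto simp: closedin_def)
    moreover have "{n \<in> M. x n \<notin> topspace X - T} = M" using K M by auto
    ultimately show False using M by simp
  qed
  moreover have "x ` M \<subseteq> T" using M K by blast
  ultimately have "I_limitin \<I> (subtopology X T) M x l"
    using l by (simp add: I_limitin_subtopology[OF I])
  then show "\<exists>M\<subseteq>K. M \<notin> \<I> \<and> (\<exists>l. I_limitin \<I> (subtopology X T) M x l)"
    using M by blast
qed

lemma I_compactin_Un:
  assumes I: "nat_ideal \<I>" and S: "I_compactin \<I> X S" and T: "I_compactin \<I> X T"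
  shows "I_compactin \<I> X (S \<union> T)"
  unfolding I_compactin_def I_compact_space_def
proof (intro conjI allI impI)
  show "S \<union> T \<subseteq> topspace X" using S T unfolding I_compactin_def by blast
  fix K and x :: "nat \<Rightarrow> 'a"
  assume "K \<notin> \<I> \<and> x ` K \<subseteq> topspace (subtopology X (S \<union> T))"
  then have K: "K \<notin> \<I>" "x ` K \<subseteq> topspace X \<inter> (S \<union> T)" by auto
  have "K = {n \<in> K. x n \<in> S} \<union> {n \<in> K. x n \<in> T}" using K by auto
  with K I have "{n \<in> K. x n \<in> S} \<notin> \<I> \<or> {n \<in> K. x n \<in> T} \<notin> \<I>"
    unfolding nat_ideal_def by metis
  then obtain R where R: "I_compactin \<I> X R" "R \<subseteq> S \<union> T" "{n \<in> K. x n \<in> R} \<notin> \<I>"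
    using S T by blast
  have "x ` {n \<in> K. x n \<in> R} \<subseteq> topspace (subtopology X R)" using K by auto
  with R obtain M l where M: "M \<subseteq> {n \<in> K. x n \<in> R}" "M \<notin> \<I>" "I_limitin \<I> (subtopology X R) M x l"
    unfolding I_compactin_def I_compact_space_def by meson
  then have "I_limitin \<I> (subtopology X (S \<union> T)) M x l"
    using R unfolding I_limitin_subtopology[OF I] by blast
  then show "\<exists>M\<subseteq>K. M \<notin> \<I> \<and> (\<exists>l. I_limitin \<I> (subtopology X (S \<union> T)) M x l)"
    using M by blast
qed

lemma I_compactification_open_iff:
  "I_compactification_open \<I> X W \<longleftrightarrow>
     openin X (Some -` W) \<and> (None \<in> W \<longrightarrow> I_compactin \<I> X (topspace X - Some -` W))"
  (is "_ = ?R")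
proof
  have [simp]: "Some -` (Some ` U) = U" for U :: "'a set" by auto
  have [simp]: "Some -` (insert None (Some ` U)) = U" for U :: "'a set" by auto
  show ?R if "I_compactification_open \<I> X W"
    using that unfolding I_compactification_open_def
    by (auto simp: closedin_def Diff_Diff_Int inf_absorb2)
next
  assume R: ?R
  show "I_compactification_open \<I> X W"
  proof (cases "None \<in> W")
    case True
    then have "W = insert None (Some ` (Some -` W))"
      by (auto simp: image_iff)
    then show ?thesis using R True unfolding I_compactification_open_def
      by (meson closedin_diff closedin_topspace openin_subset)
  next
    case False
    then have "W = Some ` (Some -` W)"
      by (auto simp: image_iff) (metis not_None_eq)
    then show ?thesis using R unfolding I_compactification_open_def by blast
  qed
qed

lemma istopology_I_compactification_open:
  assumes I: "nat_ideal \<I>"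
  shows "istopology (I_compactification_open \<I> X)"
  unfolding istopology_def
proof (intro conjI allI impI)
  fix V W assume "I_compactification_open \<I> X V" "I_compactification_open \<I> X W"
  then show "I_compactification_open \<I> X (V \<inter> W)"
    unfolding I_compactification_open_iff
    using I_compactin_Un[OF I] by (auto simp: Diff_Int)
next
  fix \<K> assume K: "\<forall>W\<in>\<K>. I_compactification_open \<I> X W"
  have "Some -` (\<Union>\<K>) = (\<Union>W\<in>\<K>. Some -` W)" by auto
  then have op: "openin X (Some -` (\<Union>\<K>))"
    using K unfolding I_compactification_open_iff by auto
  have "I_compactin \<I> X (topspace X - Some -` (\<Union>\<K>))" if W: "W \<in> \<K>" "None \<in> W" for W
  proof (rule I_compactin_closed_subset[OF I])
    show "I_compactin \<I> X (topspace X - Some -` W)"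
      using W K unfolding I_compactification_open_iff by blast
    show "closedin X (topspace X - Some -` (\<Union>\<K>))" using op by blast
    show "topspace X - Some -` \<Union> \<K> \<subseteq> topspace X - Some -` W" using W by auto
  qed
  with op show "I_compactification_open \<I> X (\<Union>\<K>)"
    unfolding I_compactification_open_iff by blast
qed

lemma openin_I_compactification:
  assumes "nat_ideal \<I>"
  shows "openin (I_compactification \<I> X) W \<longleftrightarrow> I_compactification_open \<I> X W"
  unfolding I_compactification_def
  by (simp add: istopology_I_compactification_open[OF assms])

lemma I_limitin_continuous_map:
  assumes I: "nat_ideal \<I>" and g: "continuous_map X Y g" and l: "I_limitin \<I> X M x l"
  shows "I_limitin \<I> Y M (\<lambda>n. g (x n)) (g l)"
  unfolding I_limitin_iff[OF I]
proof (intro conjI allI impI)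
  have l': "x ` M \<subseteq> topspace X" "l \<in> topspace X"
    using l unfolding I_limitin_iff[OF I] by auto
  show "(\<lambda>n. g (x n)) ` M \<subseteq> topspace Y" "g l \<in> topspace Y"
    using l' g unfolding continuous_map_def by auto
  fix U assume U: "openin Y U \<and> g l \<in> U"
  have "{n \<in> M. x n \<notin> {u \<in> topspace X. g u \<in> U}} \<in> \<I>"
    using l U g l' unfolding I_limitin_iff[OF I] continuous_map_def by auto
  moreover have "{n \<in> M. x n \<notin> {u \<in> topspace X. g u \<in> U}} = {n \<in> M. g (x n) \<notin> U}"
    using l' by auto
  ultimately show "{n \<in> M. g (x n) \<notin> U} \<in> \<I>" by simp
qed

lemma I_closedin_iff:
  assumes I: "nontrivial_ideal \<I>"
  shows "I_closedin \<I> X A \<longleftrightarrow>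
     A \<subseteq> topspace X \<and> (\<forall>L x l. L \<notin> \<I> \<and> x ` L \<subseteq> A \<and> I_limitin \<I> X L x l \<longrightarrow> l \<in> A)"
proof -
  have I': "nat_ideal \<I>" "UNIV \<notin> \<I>" "{} \<in> \<I>"
    using I unfolding nontrivial_ideal_def nat_ideal_def by auto
  have "I_limitin \<I> X UNIV (\<lambda>_. l) l" if "l \<in> topspace X" for l
    unfolding I_limitin_iff[OF I'(1)] using that I'(3) by auto
  then have const: "\<exists>L x. L \<notin> \<I> \<and> x ` L \<subseteq> A \<and> I_limitin \<I> X L x l"
    if "l \<in> A" "A \<subseteq> topspace X" for l
    using that I'(2) by (intro exI[of _ UNIV] exI[of _ "\<lambda>_. l"]) auto
  have top: "l \<in> topspace X" if "I_limitin \<I> X L x l" for L x l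
    using that unfolding I_limitin_def by blast
  show ?thesis unfolding I_closedin_def using const top by (auto; blast)
qed

lemma I_proper_map_transfer:
  fixes X :: "'a topology" and Y :: "'b topology"
  assumes I: "nontrivial_ideal \<I>" and inf: "infinite (UNIV :: 'z set)"
    and f: "I_proper_map TYPE('z) \<I> X Y f"
  shows "I_proper_map TYPE('w) \<I> X Y f"
  unfolding I_proper_map_def
proof (intro conjI allI)
  have I': "nat_ideal \<I>" using I unfolding nontrivial_ideal_def by blast
  show "I_continuous_map \<I> X Y f" using f unfolding I_proper_map_def by blast
  then have fim: "f ` topspace X \<subseteq> topspace Y" unfolding I_continuous_map_def by blast
  fix W :: "'w topology"
  show "I_closed_map \<I> (prod_topology X W) (prod_topology Y W) (\<lambda>(x, z). (f x, z))"
    unfolding I_closed_map_def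
  proof (intro conjI allI impI)
    show "(\<lambda>(x, z). (f x, z)) ` topspace (prod_topology X W) \<subseteq> topspace (prod_topology Y W)"
      using fim by auto
    fix A assume A: "I_closedin \<I> (prod_topology X W) A"
    then have Asub: "A \<subseteq> topspace X \<times> topspace W"
      unfolding I_closedin_iff[OF I] by auto
    show "I_closedin \<I> (prod_topology Y W) ((\<lambda>(x, z). (f x, z)) ` A)"
      unfolding I_closedin_iff[OF I]
    proof (intro conjI allI impI)
      show "(\<lambda>(x, z). (f x, z)) ` A \<subseteq> topspace (prod_topology Y W)"
        using Asub fim by auto
      fix L s l
      assume "L \<notin> \<I> \<and> s ` L \<subseteq> (\<lambda>(x, z). (f x, z)) ` A \<and> I_limitin \<I> (prod_topology Y W) L s l"
      then have L: "L \<notin> \<I>" and s: "s ` L \<subseteq> (\<lambda>(x, z). (f x, z)) ` A"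
        and lim: "I_limitin \<I> (prod_topology Y W) L s l" by auto
      define C where "C = insert (snd l) ((snd \<circ> s) ` L)"
      have C: "countable C" "C \<subseteq> topspace W"
        using lim unfolding C_def I_limitin_iff[OF I'] by auto
      obtain e :: "nat \<Rightarrow> 'z" where e: "inj e"
        using inf infinite_countable_subset by blast
      define h where "h = e \<circ> to_nat_on C"
      have h: "inj_on h C" unfolding h_def
        using e C(1) by (meson comp_inj_on inj_on_subset inj_on_to_nat_on subset_UNIV)
      define k where "k = inv_into C h"
      have kh: "k (h c) = c" if "c \<in> C" for c using that h by (simp add: k_def)
      define Z where "Z = pullback_topology (h ` C) k W"
      have topZ: "topspace Z = h ` C"
        unfolding Z_def topspace_pullback_topology using kh C by auto
      have k: "continuous_map Z W k"
        unfolding Z_def using continuous_map_pullback[OF continuous_map_id] by fastforce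
      have "continuous_map (subtopology W C) W (k \<circ> h)"
        by (rule continuous_map_eq[of _ _ id]) (auto simp: kh continuous_map_from_subtopology)
      then have hc: "continuous_map (subtopology W C) Z h"
        unfolding Z_def by (rule continuous_map_pullback') auto
      define A' where "A' = {p \<in> topspace X \<times> h ` C. (fst p, k (snd p)) \<in> A}"
      have "continuous_map (prod_topology X Z) (prod_topology X W) (\<lambda>p. (fst p, k (snd p)))"
        by (intro continuous_map_pairedI continuous_map_fst
            continuous_map_compose[OF continuous_map_snd k, unfolded comp_def])
      then have "I_closedin \<I> (prod_topology X Z) A'"
        unfolding I_closedin_iff[OF I]
      proof (intro conjI allI impI)
        show "A' \<subseteq> topspace (prod_topology X Z)" unfolding A'_def by (auto simp: topZ)
        fix L t m
        assume c: "continuous_map (prod_topology X Z) (prod_topology X W) (\<lambda>p. (fst p, k (snd p)))"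
        assume t: "L \<notin> \<I> \<and> t ` L \<subseteq> A' \<and> I_limitin \<I> (prod_topology X Z) L t m"
        then have "I_limitin \<I> (prod_topology X W) L (\<lambda>n. (fst (t n), k (snd (t n)))) (fst m, k (snd m))"
          using I_limitin_continuous_map[OF I' c] by blast
        moreover have "(\<lambda>n. (fst (t n), k (snd (t n)))) ` L \<subseteq> A"
          using t unfolding A'_def by auto
        ultimately have "(fst m, k (snd m)) \<in> A"
          using A t unfolding I_closedin_iff[OF I] by blast
        moreover have "m \<in> topspace X \<times> h ` C"
          using t unfolding I_limitin_def by (simp add: topZ)
        ultimately show "m \<in> A'" unfolding A'_def by auto
      qed
      then have cl: "I_closedin \<I> (prod_topology Y Z) ((\<lambda>(x, z). (f x, z)) ` A')"
        using f unfolding I_proper_map_def I_closed_map_def by blast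
      have sC: "snd (s n) \<in> C" if "n \<in> L" for n using that by (auto simp: C_def)
      have "I_limitin \<I> (subtopology (prod_topology Y W) (topspace Y \<times> C)) L s l"
      proof -
        have "s ` L \<subseteq> topspace Y \<times> topspace W" "l \<in> topspace Y \<times> topspace W"
          using lim unfolding I_limitin_def by auto
        moreover have "snd l \<in> C" by (simp add: C_def)
        ultimately show ?thesis
          unfolding I_limitin_subtopology[OF I']
          using lim sC by (simp add: image_subset_iff mem_Times_iff)
      qed
      then have lim': "I_limitin \<I> (prod_topology Y (subtopology W C)) L s l"
        by (simp add: prod_topology_subtopology)
      have "continuous_map (prod_topology Y (subtopology W C)) (prod_topology Y Z)
              (\<lambda>p. (fst p, h (snd p)))"
        by (intro continuous_map_pairedI continuous_map_fst
            continuous_map_compose[OF continuous_map_snd hc, unfolded comp_def])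
      from I_limitin_continuous_map[OF I' this lim']
      have "I_limitin \<I> (prod_topology Y Z) L (\<lambda>n. (fst (s n), h (snd (s n)))) (fst l, h (snd l))" .
      moreover have "(\<lambda>n. (fst (s n), h (snd (s n)))) ` L \<subseteq> (\<lambda>(x, z). (f x, z)) ` A'"
      proof clarsimp
        fix n assume n: "n \<in> L"
        then obtain x z where xz: "(x, z) \<in> A" "s n = (f x, z)" using s by auto
        have "(x, h z) \<in> A'" using xz sC[OF n] Asub kh by (auto simp: A'_def)
        then show "(fst (s n), h (snd (s n))) \<in> (\<lambda>(x, z). (f x, z)) ` A'"
          using xz by (auto intro!: image_eqI[of _ _ "(x, h z)"])
      qed
      ultimately have "(fst l, h (snd l)) \<in> (\<lambda>(x, z). (f x, z)) ` A'"
        using cl L unfolding I_closedin_iff[OF I] by blast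
      then obtain x where "(x, h (snd l)) \<in> A'" "f x = fst l" by auto
      moreover have "k (h (snd l)) = snd l" by (simp add: kh C_def)
      ultimately have "(x, snd l) \<in> A" "f x = fst l" by (auto simp: A'_def)
      then show "l \<in> (\<lambda>(x, z). (f x, z)) ` A"
        by (auto intro!: image_eqI[of _ _ "(x, snd l)"])
    qed
  qed
qed

end

theory Submission
  imports Defs
begin

text \<open>
  Both directions pass through the condition that \<open>f\<close> pulls closed \<open>\<I>\<close>-compact sets back to
  \<open>\<I>\<close>-compact sets, which is what continuity of the extension at infinity says. By condition (C) every
  nonthin index set contains a nonthin \<open>B\<close> whose thin subsets are exactly the finite ones, so that
  along \<open>B\<close> one deals with ordinary convergence.

  If \<open>f\<close> pulls back \<open>\<I>\<close>-compact sets and \<open>f (x\<^sub>n) \<longrightarrow> y\<close> along \<open>B\<close>, then \<open>{y} \<union> {f (x\<^sub>n)}\<close> is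
  \<open>\<I>\<close>-compact and closed, so \<open>(x\<^sub>n)\<close> has an \<open>\<I>\<close>-convergent nonthin subsequence; its limit is
  mapped to \<open>y\<close>. Conversely, if \<open>f (x\<^sub>n) \<longrightarrow> y\<close> along \<open>B\<close> but \<open>(x\<^sub>n)\<close> has no \<open>\<I>\<close>-convergent nonthin
  subsequence, then the graph \<open>{(x\<^sub>n, n)}\<close> is \<open>\<I>\<close>-closed in \<open>X \<times> (\<nat> \<union> {\<infinity>})\<close>, whereas its image
  under \<open>f \<times> 1\<close> misses its limit \<open>(y, \<infinity>)\<close>.
\<close>

section \<open>Ideals on the naturals and condition (C)\<close>

lemma admissible_ideal_imp_nontrivial: "admissible_ideal \<I> \<Longrightarrow> nontrivial_ideal \<I>"
  by (simp add: admissible_ideal_def)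

lemma nontrivial_ideal_imp_nat_ideal: "nontrivial_ideal \<I> \<Longrightarrow> nat_ideal \<I>"
  by (simp add: nontrivial_ideal_def)

lemma nat_ideal_empty: "nat_ideal \<I> \<Longrightarrow> {} \<in> \<I>"
  by (simp add: nat_ideal_def)

lemma nat_ideal_subset: "nat_ideal \<I> \<Longrightarrow> A \<in> \<I> \<Longrightarrow> B \<subseteq> A \<Longrightarrow> B \<in> \<I>"
  by (simp add: nat_ideal_def)

lemma nat_ideal_Un: "nat_ideal \<I> \<Longrightarrow> A \<in> \<I> \<Longrightarrow> B \<in> \<I> \<Longrightarrow> A \<union> B \<in> \<I>"
  by (simp add: nat_ideal_def)

lemma nat_ideal_UN_finite:
  assumes "nat_ideal \<I>" "finite S" "\<And>s. s \<in> S \<Longrightarrow> A s \<in> \<I>"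
  shows "(\<Union>s\<in>S. A s) \<in> \<I>"
  using assms(2,3)
  by (induction S rule: finite_induct) (auto simp: nat_ideal_empty nat_ideal_Un assms(1))

lemma admissible_ideal_finite:
  assumes "admissible_ideal \<I>" "finite A"
  shows "A \<in> \<I>"
proof -
  have "(\<Union>n\<in>A. {n}) \<in> \<I>"
    using assms nat_ideal_UN_finite[of \<I> A "\<lambda>n. {n}"]
    by (simp add: admissible_ideal_def nontrivial_ideal_def)
  then show ?thesis by simp
qed

text \<open>Condition (C) makes thin subsets of \<open>B\<close> finite, and admissibility makes
  finite sets thin. The equivalence allows passage in both directions between
  \<open>\<I>\<close>-convergence and ordinary convergence along \<open>B\<close>.\<close>

lemma shrinking_C_obtain:
  assumes "admissible_ideal \<I>" "shrinking_C \<I>" "A \<notin> \<I>"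
  obtains B where "B \<subseteq> A" "B \<notin> \<I>" "\<And>C. C \<subseteq> B \<Longrightarrow> C \<in> \<I> \<longleftrightarrow> finite C"
proof -
  obtain B where "B \<subseteq> A" "B \<notin> \<I>" "\<forall>C\<subseteq>B. infinite C \<longrightarrow> C \<notin> \<I>"
    using assms(2,3) unfolding shrinking_C_def by blast
  with that admissible_ideal_finite[OF assms(1)] show thesis by blast
qed

section \<open>Convergence along an index set\<close>

lemma I_limitinD:
  assumes "nat_ideal \<I>" "I_limitin \<I> X M x l" "openin X U" "l \<in> U"
  shows "{n \<in> M. x n \<notin> U} \<in> \<I>"
  using assms(2-) unfolding I_limitin_iff[OF assms(1)] by blast

lemma I_limitin_subset:
  assumes I: "nat_ideal \<I>" and l: "I_limitin \<I> X M x l" and "N \<subseteq> M"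
  shows "I_limitin \<I> X N x l"
  unfolding I_limitin_iff[OF I]
proof (intro conjI allI impI)
  show "x ` N \<subseteq> topspace X" "l \<in> topspace X"
    using l \<open>N \<subseteq> M\<close> unfolding I_limitin_iff[OF I] by auto
  fix U assume "openin X U \<and> l \<in> U"
  then have "{n \<in> M. x n \<notin> U} \<in> \<I>" using I_limitinD[OF I l] by blast
  then show "{n \<in> N. x n \<notin> U} \<in> \<I>"
    by (rule nat_ideal_subset[OF I]) (use \<open>N \<subseteq> M\<close> in auto)
qed

text \<open>Serves sequences obtained by choice, which are known to match a given one on the index
  set only.\<close>

lemma I_limitin_cong:
  assumes "\<And>n. n \<in> M \<Longrightarrow> x n = x' n"
  shows "I_limitin \<I> X M x l \<longleftrightarrow> I_limitin \<I> X M x' l"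
proof -
  have "{n \<in> M. x n \<notin> U} = {n \<in> M. x' n \<notin> U}" for U using assms by auto
  moreover have "x ` M = x' ` M" using assms by (rule image_cong[OF refl])
  ultimately show ?thesis unfolding I_limitin_def by simp
qed

lemma I_limitin_const:
  assumes I: "nat_ideal \<I>" and "c \<in> topspace X" "\<And>n. n \<in> M \<Longrightarrow> x n = c"
  shows "I_limitin \<I> X M x c"
proof -
  have "{n \<in> M. x n \<notin> U} \<in> \<I>" if "c \<in> U" for U
    by (rule nat_ideal_subset[OF I nat_ideal_empty[OF I]]) (use assms(3) that in auto)
  then show ?thesis unfolding I_limitin_iff[OF I] using assms(2,3) by auto
qed

lemma I_limitin_unique:
  assumes "I_US \<I> X" "M \<notin> \<I>" "I_limitin \<I> X M x l" "I_limitin \<I> X M x l'"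
  shows "l = l'"
  using assms unfolding I_US_def by blast

lemma I_closedin_limit:
  assumes "nontrivial_ideal \<I>" "I_closedin \<I> X A" "L \<notin> \<I>" "x ` L \<subseteq> A" "I_limitin \<I> X L x l"
  shows "l \<in> A"
  using assms(2-) unfolding I_closedin_iff[OF assms(1)] by meson

lemma I_limitin_prod_topology:
  assumes I: "nat_ideal \<I>" and a: "I_limitin \<I> X M x a" and b: "I_limitin \<I> Z M z b"
  shows "I_limitin \<I> (prod_topology X Z) M (\<lambda>n. (x n, z n)) (a, b)"
  unfolding I_limitin_iff[OF I]
proof (intro conjI allI impI)
  show "(\<lambda>n. (x n, z n)) ` M \<subseteq> topspace (prod_topology X Z)" "(a, b) \<in> topspace (prod_topology X Z)"
    using a b unfolding I_limitin_iff[OF I] by auto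
  fix W assume "openin (prod_topology X Z) W \<and> (a, b) \<in> W"
  then obtain U V where U: "openin X U" "a \<in> U" and V: "openin Z V" "b \<in> V" and W: "U \<times> V \<subseteq> W"
    unfolding openin_prod_topology_alt by blast
  have "{n \<in> M. x n \<notin> U} \<union> {n \<in> M. z n \<notin> V} \<in> \<I>"
    by (rule nat_ideal_Un[OF I I_limitinD[OF I a U] I_limitinD[OF I b V]])
  then show "{n \<in> M. (x n, z n) \<notin> W} \<in> \<I>"
    by (rule nat_ideal_subset[OF I]) (use W in auto)
qed

section \<open>Sets that are \<open>\<I>\<close>-compact\<close>

lemma I_compactin_iff:
  assumes I: "nat_ideal \<I>"
  shows "I_compactin \<I> X S \<longleftrightarrow> S \<subseteq> topspace X \<and>
     (\<forall>K x. K \<notin> \<I> \<and> x ` K \<subseteq> S \<longrightarrow> (\<exists>M\<subseteq>K. M \<notin> \<I> \<and> (\<exists>l\<in>S. I_limitin \<I> X M x l)))"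
proof (cases "S \<subseteq> topspace X")
  case True
  then have top: "topspace (subtopology X S) = S" by auto
  \<comment> \<open>Limits in a subspace are limits in \<open>X\<close> that lie in
    \<open>S\<close>. The terms of a subsequence lie in \<open>S\<close> already, so only the limit
    has to be required there.\<close>
  have "(\<exists>l. x ` M \<subseteq> S \<and> l \<in> S \<and> I_limitin \<I> X M x l) \<longleftrightarrow> (\<exists>l\<in>S. I_limitin \<I> X M x l)"
    if "x ` K \<subseteq> S" "M \<subseteq> K" for K M and x :: "nat \<Rightarrow> 'a"
  proof -
    have "x ` M \<subseteq> S" using that by blast
    then show ?thesis by (simp add: Bex_def)
  qed
  with True show ?thesis
    unfolding I_compactin_def I_compact_space_def I_limitin_subtopology[OF I] top by meson
qed (simp add: I_compactin_def)

text \<open>Compactness gives a subsequence with a limit in \<open>S\<close>, and uniqueness of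
  limits identifies it with the given limit \<open>l\<close>. In an \<open>\<I>\<close>-sequential
  space \<open>S\<close> is then closed.\<close>

lemma I_compactin_imp_I_closedin:
  assumes I: "nontrivial_ideal \<I>" and US: "I_US \<I> X" and S: "I_compactin \<I> X S"
  shows "I_closedin \<I> X S"
  unfolding I_closedin_iff[OF I]
proof (intro conjI allI impI)
  note I' = nontrivial_ideal_imp_nat_ideal[OF I]
  show "S \<subseteq> topspace X" using S by (simp add: I_compactin_def)
  fix L x l assume "L \<notin> \<I> \<and> x ` L \<subseteq> S \<and> I_limitin \<I> X L x l"
  then have L: "L \<notin> \<I>" "x ` L \<subseteq> S" "I_limitin \<I> X L x l" by auto
  then obtain M m where M: "M \<subseteq> L" "M \<notin> \<I>" "m \<in> S" "I_limitin \<I> X M x m"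
    using S unfolding I_compactin_iff[OF I'] by meson
  then have "l = m"
    by (intro I_limitin_unique[OF US M(2) I_limitin_subset[OF I' L(3) M(1)]])
  then show "l \<in> S" using M(3) by simp
qed

text \<open>
  A nonthin sequence in this set either takes some value on a nonthin set of indices, or has only
  thin fibres and then \<open>\<I>\<close>-converges to \<open>y\<close>.
\<close>

lemma I_compactin_convergent_sequence:
  assumes I: "nat_ideal \<I>" and y: "y \<in> topspace Y" and g: "g ` B \<subseteq> topspace Y"
    and conv: "\<And>U. openin Y U \<Longrightarrow> y \<in> U \<Longrightarrow> finite {n \<in> B. g n \<notin> U}"
  shows "I_compactin \<I> Y (insert y (g ` B))"
  unfolding I_compactin_iff[OF I]
proof (intro conjI allI impI)
  show "insert y (g ` B) \<subseteq> topspace Y" using y g by blast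
  fix K s assume K: "K \<notin> \<I> \<and> s ` K \<subseteq> insert y (g ` B)"
  show "\<exists>M\<subseteq>K. M \<notin> \<I> \<and> (\<exists>l\<in>insert y (g ` B). I_limitin \<I> Y M s l)"
  proof (cases "\<exists>v. {k \<in> K. s k = v} \<notin> \<I>")
    case True
    then obtain v where v: "{k \<in> K. s k = v} \<notin> \<I>" by blast
    then have "{k \<in> K. s k = v} \<noteq> {}" using nat_ideal_empty[OF I] by metis
    then have vin: "v \<in> insert y (g ` B)" using K by auto
    moreover have "I_limitin \<I> Y {k \<in> K. s k = v} s v"
      by (rule I_limitin_const[OF I]) (use vin y g in auto)
    moreover have "{k \<in> K. s k = v} \<subseteq> K" by blast
    ultimately show ?thesis using v by meson
  next
    case False
    have "I_limitin \<I> Y K s y"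
      unfolding I_limitin_iff[OF I]
    proof (intro conjI allI impI)
      have "s ` K \<subseteq> insert y (g ` B)" using K by blast
      also have "\<dots> \<subseteq> topspace Y" using y g by blast
      finally show "s ` K \<subseteq> topspace Y" .
      show "y \<in> topspace Y" by (fact y)
      fix U assume U: "openin Y U \<and> y \<in> U"
      \<comment> \<open>Only finitely many values of \<open>g\<close> lie outside \<open>U\<close>
        and every fibre of \<open>s\<close> is thin, so the exceptional indices lie in a finite
        union of thin sets.\<close>
      have "(\<Union>v\<in>g ` {n \<in> B. g n \<notin> U}. {k \<in> K. s k = v}) \<in> \<I>"
        using False conv U by (intro nat_ideal_UN_finite[OF I]) auto
      then show "{k \<in> K. s k \<notin> U} \<in> \<I>"
      proof (rule nat_ideal_subset[OF I], intro subsetI)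
        fix k assume k: "k \<in> {k \<in> K. s k \<notin> U}"
        then have "s k \<in> insert y (g ` B)" using K by blast
        with k U show "k \<in> (\<Union>v\<in>g ` {n \<in> B. g n \<notin> U}. {k \<in> K. s k = v})" by auto
      qed
    qed
    with K show ?thesis by (meson insertI1 order_refl)
  qed
qed

text \<open>Only the empty index set carries a sequence in the empty set, and it is thin. This makes
  the whole compactification open.\<close>

lemma I_compactin_empty:
  assumes I: "nat_ideal \<I>"
  shows "I_compactin \<I> X {}"
  unfolding I_compactin_iff[OF I]
proof (intro conjI allI impI)
  fix K and x :: "nat \<Rightarrow> 'a" assume K: "K \<notin> \<I> \<and> x ` K \<subseteq> {}"
  from K have "K \<notin> \<I>" by (rule conjunct1)
  moreover from K have "K = {}" by simp
  ultimately show "\<exists>M\<subseteq>K. M \<notin> \<I> \<and> (\<exists>l\<in>{}. I_limitin \<I> X M x l)"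
    using nat_ideal_empty[OF I] by simp
qed simp

section \<open>The one point compactification\<close>

lemma topspace_I_compactification:
  assumes I: "nat_ideal \<I>"
  shows "topspace (I_compactification \<I> X) = insert None (Some ` topspace X)"
proof (rule equalityI)
  \<comment> \<open>Every open set has an open trace on \<open>X\<close>; this is applied to the
    carrier, which is the largest open set.\<close>
  have "openin X (Some -` topspace (I_compactification \<I> X))"
    using openin_topspace[of "I_compactification \<I> X"]
    unfolding openin_I_compactification[OF I] I_compactification_open_iff by (rule conjunct1)
  then have sub: "Some -` topspace (I_compactification \<I> X) \<subseteq> topspace X" by (rule openin_subset)
  show "topspace (I_compactification \<I> X) \<subseteq> insert None (Some ` topspace X)"
  proof
    fix p assume "p \<in> topspace (I_compactification \<I> X)"
    then show "p \<in> insert None (Some ` topspace X)" using sub by (cases p) auto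
  qed
  have "Some -` insert None (Some ` topspace X) = topspace X" by auto
  then have "openin (I_compactification \<I> X) (insert None (Some ` topspace X))"
    unfolding openin_I_compactification[OF I] I_compactification_open_iff
    by (simp add: I_compactin_empty[OF I])
  then show "insert None (Some ` topspace X) \<subseteq> topspace (I_compactification \<I> X)"
    by (rule openin_subset)
qed

text \<open>Open sets without \<open>None\<close> are handled by continuity of \<open>f\<close>. An
  open set containing \<open>None\<close> omits exactly a closed \<open>\<I>\<close>-compact
  \<open>K\<close> of \<open>Y\<close>, and its preimage omits exactly the preimage of
  \<open>K\<close>.\<close>

lemma continuous_map_I_compactification_iff:
  assumes I: "nat_ideal \<I>" and f: "continuous_map X Y f"
  shows "continuous_map (I_compactification \<I> X) (I_compactification \<I> Y) (map_option f) \<longleftrightarrow>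
     (\<forall>K. closedin Y K \<and> I_compactin \<I> Y K \<longrightarrow> I_compactin \<I> X {x \<in> topspace X. f x \<in> K})"
    (is "?L \<longleftrightarrow> ?R")
proof -
  have fim: "f x \<in> topspace Y" if "x \<in> topspace X" for x
    using f that by (auto simp: continuous_map_def)
  have vim: "Some -` {p \<in> insert None (Some ` topspace X). map_option f p \<in> W}
      = {x \<in> topspace X. f x \<in> Some -` W}" for W
    by auto
  have pre: "topspace X - {x \<in> topspace X. f x \<in> V} = {x \<in> topspace X. f x \<in> topspace Y - V}" for V
    using fim by auto
  have "?L \<longleftrightarrow> (\<forall>W. I_compactification_open \<I> Y W \<longrightarrow> None \<in> W \<longrightarrow>
      I_compactin \<I> X {x \<in> topspace X. f x \<in> topspace Y - Some -` W})"
    using f fim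
    unfolding continuous_map_def topspace_I_compactification[OF I] openin_I_compactification[OF I]
      I_compactification_open_iff[of \<I> X] vim pre
    by (auto simp: I_compactification_open_iff)
  also have "\<dots> \<longleftrightarrow> ?R"
  proof (intro iffI allI impI)
    fix K assume *: "\<forall>W. I_compactification_open \<I> Y W \<longrightarrow> None \<in> W \<longrightarrow>
      I_compactin \<I> X {x \<in> topspace X. f x \<in> topspace Y - Some -` W}"
      and K: "closedin Y K \<and> I_compactin \<I> Y K"
    \<comment> \<open>The neighbourhood of infinity that leaves out exactly
      \<open>K\<close>.\<close>
    let ?W = "insert None (Some ` (topspace Y - K))"
    have V: "Some -` ?W = topspace Y - K" by auto
    have KK: "topspace Y - (topspace Y - K) = K" using K closedin_subset by blast
    have "I_compactification_open \<I> Y ?W"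
      unfolding I_compactification_open_iff V KK using K by blast
    with * have "I_compactin \<I> X {x \<in> topspace X. f x \<in> topspace Y - Some -` ?W}" by blast
    then show "I_compactin \<I> X {x \<in> topspace X. f x \<in> K}" unfolding V KK .
  next
    fix W assume ?R and W: "I_compactification_open \<I> Y W" "None \<in> W"
    then have "closedin Y (topspace Y - Some -` W)" "I_compactin \<I> Y (topspace Y - Some -` W)"
      by (auto simp: I_compactification_open_iff)
    with \<open>?R\<close> show "I_compactin \<I> X {x \<in> topspace X. f x \<in> topspace Y - Some -` W}" by blast
  qed
  finally show ?thesis .
qed

section \<open>From \<open>\<I>\<close>-compact preimages to properness\<close>

lemma I_proper_map_if_I_compact_preimages:
  assumes I: "admissible_ideal \<I>" and C: "shrinking_C \<I>"
    and Y: "I_sequential \<I> Y" "I_US \<I> Y" and f: "continuous_map X Y f"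
    and pre: "\<And>K. closedin Y K \<Longrightarrow> I_compactin \<I> Y K \<Longrightarrow> I_compactin \<I> X {x \<in> topspace X. f x \<in> K}"
  shows "I_proper_map TYPE('z) \<I> X Y f"
  unfolding I_proper_map_def
proof (intro conjI allI)
  note I1 = admissible_ideal_imp_nontrivial[OF I]
  note I' = nontrivial_ideal_imp_nat_ideal[OF I1]
  have fim: "f ` topspace X \<subseteq> topspace Y" using f by (auto simp: continuous_map_def)
  show "I_continuous_map \<I> X Y f"
    unfolding I_continuous_map_def using fim I_limitin_continuous_map[OF I' f] by blast
  fix Z :: "'z topology"
  let ?F = "\<lambda>(x, z). (f x, z :: 'z)"
  show "I_closed_map \<I> (prod_topology X Z) (prod_topology Y Z) ?F"
    unfolding I_closed_map_def
  proof (intro conjI allI impI)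
    show "?F ` topspace (prod_topology X Z) \<subseteq> topspace (prod_topology Y Z)" using fim by auto
    fix A assume A: "I_closedin \<I> (prod_topology X Z) A"
    then have Asub: "A \<subseteq> topspace X \<times> topspace Z" by (auto simp: I_closedin_iff[OF I1])
    show "I_closedin \<I> (prod_topology Y Z) (?F ` A)"
      unfolding I_closedin_iff[OF I1]
    proof (intro conjI allI impI)
      show "?F ` A \<subseteq> topspace (prod_topology Y Z)" using Asub fim by auto
      fix L s l
      assume "L \<notin> \<I> \<and> s ` L \<subseteq> ?F ` A \<and> I_limitin \<I> (prod_topology Y Z) L s l"
      then have L: "L \<notin> \<I>" "s ` L \<subseteq> ?F ` A" "I_limitin \<I> (prod_topology Y Z) L s l" by auto
      obtain y z where l: "l = (y, z)" by (cases l)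
      \<comment> \<open>Lift the sequence \<open>s\<close> to points of \<open>A\<close>; the lift
        is controlled only on \<open>L\<close>.\<close>
      have "\<forall>n\<in>L. \<exists>p. p \<in> A \<and> s n = ?F p" using L(2) by blast
      then obtain p where p: "\<And>n. n \<in> L \<Longrightarrow> p n \<in> A \<and> s n = ?F (p n)" by metis
      define x where "x = (\<lambda>n. fst (p n))"
      define w where "w = (\<lambda>n. snd (p n))"
      have xw: "(x n, w n) \<in> A" "s n = (f (x n), w n)" if "n \<in> L" for n
        using p[OF that] by (auto simp: x_def w_def split: prod.splits)
      \<comment> \<open>Along \<open>B\<close> the thin exceptional sets are finite, as
        \<open>I_compactin_convergent_sequence\<close> requires.\<close>
      obtain B where B: "B \<subseteq> L" "B \<notin> \<I>" "\<And>C. C \<subseteq> B \<Longrightarrow> C \<in> \<I> \<longleftrightarrow> finite C"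
        using shrinking_C_obtain[OF I C L(1)] by blast
      have lim: "I_limitin \<I> (prod_topology Y Z) B s (y, z)"
        using I_limitin_subset[OF I' L(3) B(1)] l by simp
      have "I_limitin \<I> Y B (\<lambda>n. fst (s n)) y"
        using I_limitin_continuous_map[OF I' continuous_map_fst lim] by simp
      then have fy: "I_limitin \<I> Y B (\<lambda>n. f (x n)) y"
        by (rule iffD1[OF I_limitin_cong, rotated]) (use xw(2) subsetD[OF B(1)] in simp)
      have "I_limitin \<I> Z B (\<lambda>n. snd (s n)) z"
        using I_limitin_continuous_map[OF I' continuous_map_snd lim] by simp
      then have wz: "I_limitin \<I> Z B w z"
        by (rule iffD1[OF I_limitin_cong, rotated]) (use xw(2) subsetD[OF B(1)] in simp)
      let ?K = "insert y ((\<lambda>n. f (x n)) ` B)"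
      have K: "I_compactin \<I> Y ?K"
      proof (rule I_compactin_convergent_sequence[OF I'])
        show "y \<in> topspace Y" "(\<lambda>n. f (x n)) ` B \<subseteq> topspace Y"
          using fy by (auto simp: I_limitin_def)
        show "finite {n \<in> B. f (x n) \<notin> U}" if "openin Y U" "y \<in> U" for U
          using I_limitinD[OF I' fy that] B(3) by auto
      qed
      moreover have "closedin Y ?K"
        using Y I_compactin_imp_I_closedin[OF I1 Y(2) K] by (simp add: I_sequential_def)
      ultimately have "I_compactin \<I> X {x \<in> topspace X. f x \<in> ?K}" by (intro pre)
      moreover have "x ` B \<subseteq> {x \<in> topspace X. f x \<in> ?K}"
        using xw(1) B(1) Asub by auto
      ultimately obtain M a where M: "M \<subseteq> B" "M \<notin> \<I>" "I_limitin \<I> X M x a"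
        using B(2) unfolding I_compactin_iff[OF I'] by meson
      \<comment> \<open>Along \<open>M\<close> the images converge to \<open>f a\<close> by
        continuity and to \<open>y\<close> as a subsequence.\<close>
      have "f a = y"
        by (rule I_limitin_unique[OF Y(2) M(2) I_limitin_continuous_map[OF I' f M(3)]
              I_limitin_subset[OF I' fy M(1)]])
      \<comment> \<open>The second coordinates still converge to \<open>z\<close> along
        \<open>M\<close>, so \<open>(a, z)\<close> is a limit of points of \<open>A\<close>; it is
        the required preimage of \<open>l\<close>.\<close>
      have "I_limitin \<I> (prod_topology X Z) M (\<lambda>n. (x n, w n)) (a, z)"
        by (rule I_limitin_prod_topology[OF I' M(3) I_limitin_subset[OF I' wz M(1)]])
      moreover have "(\<lambda>n. (x n, w n)) ` M \<subseteq> A" using xw(1) M(1) B(1) by auto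
      ultimately have "(a, z) \<in> A" by (intro I_closedin_limit[OF I1 A M(2)])
      then show "l \<in> ?F ` A" using l \<open>f a = y\<close> by force
    qed
  qed
qed

section \<open>The naturals with a point at infinity, and graphs over them\<close>

abbreviation nat_compactification :: "nat option topology" where
  "nat_compactification \<equiv> Alexandroff_compactification (discrete_topology UNIV)"

text \<open>Compact subsets of a discrete space are finite, so each \<open>Some n\<close> is
  isolated and the open neighbourhoods of \<open>None\<close> are the cofinite sets containing
  it.\<close>

lemma openin_nat_compactification:
  "openin nat_compactification U \<longleftrightarrow> (None \<in> U \<longrightarrow> finite {n. Some n \<notin> U})"
  unfolding openin_Alexandroff_compactification
proof (intro iffI impI)
  assume "(\<exists>V. openin (discrete_topology UNIV) V \<and> U = Some ` V) \<or>
      (\<exists>C. compactin (discrete_topology UNIV) C \<and> closedin (discrete_topology UNIV) C \<and>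
        U = insert None (Some ` (topspace (discrete_topology UNIV) - C)))" "None \<in> U"
  then obtain C :: "nat set" where "finite C" "U = insert None (Some ` (- C))"
    by (auto simp: compactin_discrete_topology Compl_eq_Diff_UNIV)
  moreover have "{n. Some n \<notin> insert None (Some ` (- C))} = C" by auto
  ultimately show "finite {n. Some n \<notin> U}" by simp
next
  assume fin: "None \<in> U \<longrightarrow> finite {n. Some n \<notin> U}"
  show "(\<exists>V. openin (discrete_topology UNIV) V \<and> U = Some ` V) \<or>
      (\<exists>C. compactin (discrete_topology UNIV) C \<and> closedin (discrete_topology UNIV) C \<and>
        U = insert None (Some ` (topspace (discrete_topology UNIV) - C)))"
  proof (cases "None \<in> U")
    case True
    have "p \<in> U \<longleftrightarrow> p \<in> insert None (Some ` (UNIV - {n. Some n \<notin> U}))" for p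
      using True by (cases p) auto
    then have "U = insert None (Some ` (UNIV - {n. Some n \<notin> U}))" by (rule set_eqI)
    then show ?thesis
      using True fin by (intro disjI2 exI[of _ "{n. Some n \<notin> U}"]) (simp add: compactin_discrete_topology)
  next
    case False
    have "p \<in> U \<longleftrightarrow> p \<in> Some ` {n. Some n \<in> U}" for p
      using False by (cases p) auto
    then have "U = Some ` {n. Some n \<in> U}" by (rule set_eqI)
    then show ?thesis by (intro disjI1 exI[of _ "{n. Some n \<in> U}"]) simp
  qed
qed

text \<open>A limit over \<open>Some m\<close> is the graph point there, since \<open>Some m\<close>
  is isolated and limits in \<open>X\<close> are unique. A limit over \<open>None\<close> would
  involve infinitely many indices of \<open>B\<close>, and \<open>x\<close> would converge along
  them, against \<open>nolim\<close>.\<close>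

lemma I_closedin_graph:
  assumes I: "admissible_ideal \<I>" and C: "shrinking_C \<I>" and US: "I_US \<I> X"
    and B: "\<And>C. C \<subseteq> B \<Longrightarrow> C \<in> \<I> \<longleftrightarrow> finite C" and x: "x ` B \<subseteq> topspace X"
    and nolim: "\<And>M l. M \<subseteq> B \<Longrightarrow> M \<notin> \<I> \<Longrightarrow> \<not> I_limitin \<I> X M x l"
  shows "I_closedin \<I> (prod_topology X nat_compactification) ((\<lambda>n. (x n, Some n)) ` B)"
proof -
  note I1 = admissible_ideal_imp_nontrivial[OF I]
  note I' = nontrivial_ideal_imp_nat_ideal[OF I1]
  show ?thesis
    unfolding I_closedin_iff[OF I1]
  proof (intro conjI allI impI)
    show "(\<lambda>n. (x n, Some n)) ` B \<subseteq> topspace (prod_topology X nat_compactification)"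
      using x by auto
    fix L s l
    assume "L \<notin> \<I> \<and> s ` L \<subseteq> (\<lambda>n. (x n, Some n)) ` B \<and>
      I_limitin \<I> (prod_topology X nat_compactification) L s l"
    then have L: "L \<notin> \<I>" "s ` L \<subseteq> (\<lambda>n. (x n, Some n)) ` B"
      "I_limitin \<I> (prod_topology X nat_compactification) L s l" by auto
    obtain D where D: "D \<subseteq> L" "D \<notin> \<I>" "\<And>C. C \<subseteq> D \<Longrightarrow> C \<in> \<I> \<longleftrightarrow> finite C"
      using shrinking_C_obtain[OF I C L(1)] by blast
    have lim: "I_limitin \<I> (prod_topology X nat_compactification) D s l"
      by (rule I_limitin_subset[OF I' L(3) D(1)])
    have "\<forall>k\<in>D. \<exists>n. n \<in> B \<and> s k = (x n, Some n)" using L(2) D(1) by blast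
    \<comment> \<open>\<open>\<nu> k\<close> is the index of the graph point \<open>s k\<close>; it
      may repeat values and need not increase with \<open>k\<close>.\<close>
    then obtain \<nu> where \<nu>: "\<And>k. k \<in> D \<Longrightarrow> \<nu> k \<in> B \<and> s k = (x (\<nu> k), Some (\<nu> k))" by metis
    obtain a z where l: "l = (a, z)" by (cases l)
    have "I_limitin \<I> X D (\<lambda>k. fst (s k)) a"
      using I_limitin_continuous_map[OF I' continuous_map_fst lim] l by simp
    then have xa: "I_limitin \<I> X D (\<lambda>k. x (\<nu> k)) a"
      by (rule iffD1[OF I_limitin_cong, rotated]) (use \<nu> in simp)
    have "I_limitin \<I> nat_compactification D (\<lambda>k. snd (s k)) z"
      using I_limitin_continuous_map[OF I' continuous_map_snd lim] l by simp
    then have z: "I_limitin \<I> nat_compactification D (\<lambda>k. Some (\<nu> k)) z"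
      by (rule iffD1[OF I_limitin_cong, rotated]) (use \<nu> in simp)
    show "l \<in> (\<lambda>n. (x n, Some n)) ` B"
    proof (cases z)
      case (Some m)
      let ?E = "{k \<in> D. \<nu> k = m}"
      \<comment> \<open>As \<open>Some m\<close> is isolated, \<open>\<nu>\<close> differs from
        \<open>m\<close> only on a thin subset of \<open>D\<close>.\<close>
      have "openin nat_compactification {Some m}" by (simp add: openin_nat_compactification)
      then have "{k \<in> D. Some (\<nu> k) \<notin> {Some m}} \<in> \<I>"
        by (rule I_limitinD[OF I' z]) (simp add: Some)
      moreover have "{k \<in> D. Some (\<nu> k) \<notin> {Some m}} \<union> ?E = D" by blast
      ultimately have E: "?E \<notin> \<I>" using D(2) nat_ideal_Un[OF I'] by fastforce
      have "?E \<noteq> {}"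
      proof
        assume "?E = {}"
        with E show False by (simp only: nat_ideal_empty[OF I'] not_True_eq_False)
      qed
      then have m: "m \<in> B" using \<nu> by blast
      have "I_limitin \<I> X ?E (\<lambda>k. x (\<nu> k)) (x m)"
        by (rule I_limitin_const[OF I']) (use m x in auto)
      moreover have "I_limitin \<I> X ?E (\<lambda>k. x (\<nu> k)) a"
        by (rule I_limitin_subset[OF I' xa]) auto
      ultimately have "a = x m" by (intro I_limitin_unique[OF US E])
      then show ?thesis using l Some m by auto
    next
      case None
      \<comment> \<open>Otherwise the complement of \<open>Some\<close> \<nu> \<open>D\<close> would
        be a neighbourhood of \<open>None\<close> missed by every term, and \<open>D\<close> would
        be thin.\<close>
      have "infinite (\<nu> ` D)"
      proof
        assume "finite (\<nu> ` D)"
        moreover have "{n. Some n \<notin> - Some ` \<nu> ` D} = \<nu> ` D" by auto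
        ultimately have "openin nat_compactification (- Some ` \<nu> ` D)"
          by (simp add: openin_nat_compactification)
        then have "{k \<in> D. Some (\<nu> k) \<notin> - Some ` \<nu> ` D} \<in> \<I>"
          by (rule I_limitinD[OF I' z]) (simp add: None image_iff)
        moreover have "{k \<in> D. Some (\<nu> k) \<notin> - Some ` \<nu> ` D} = D" by auto
        ultimately show False using D(2) by simp
      qed
      moreover have sub: "\<nu> ` D \<subseteq> B" using \<nu> by auto
      \<comment> \<open>The image of a thin set under \<open>\<nu>\<close> could be nonthin in
        general. By the choice of \<open>D\<close> the exceptional sets are finite, so their images
        are finite and hence thin.\<close>
      moreover have "I_limitin \<I> X (\<nu> ` D) x a"
        unfolding I_limitin_iff[OF I']
      proof (intro conjI allI impI)
        show "x ` \<nu> ` D \<subseteq> topspace X" "a \<in> topspace X"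
          using xa unfolding I_limitin_iff[OF I'] by auto
        fix U assume "openin X U \<and> a \<in> U"
        then have "{k \<in> D. x (\<nu> k) \<notin> U} \<in> \<I>" using I_limitinD[OF I' xa] by blast
        then have "finite (\<nu> ` {k \<in> D. x (\<nu> k) \<notin> U})" using D(3) by auto
        moreover have "\<nu> ` {k \<in> D. x (\<nu> k) \<notin> U} = {n \<in> \<nu> ` D. x n \<notin> U}" by auto
        ultimately show "{n \<in> \<nu> ` D. x n \<notin> U} \<in> \<I>"
          using admissible_ideal_finite[OF I] by simp
      qed
      ultimately show ?thesis using nolim[OF sub] B[OF sub] by blast
    qed
  qed
qed

text \<open>The type argument is the point type of the test space
  \<open>nat_compactification\<close>. Properness yields a limit in \<open>X\<close>; continuity
  makes the preimage of \<open>K\<close> closed, which places the limit in it.\<close>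

lemma I_compact_preimage_if_I_proper_map:
  assumes I: "admissible_ideal \<I>" and C: "shrinking_C \<I>" and US: "I_US \<I> X"
    and f: "I_proper_map TYPE(nat option) \<I> X Y f"
    and K: "closedin Y K" "I_compactin \<I> Y K" and P: "continuous_map X Y f"
  shows "I_compactin \<I> X {x \<in> topspace X. f x \<in> K}"
proof -
  note I1 = admissible_ideal_imp_nontrivial[OF I]
  note I' = nontrivial_ideal_imp_nat_ideal[OF I1]
  let ?P = "{x \<in> topspace X. f x \<in> K}"
  show ?thesis
    unfolding I_compactin_iff[OF I']
  proof (intro conjI allI impI)
    show "?P \<subseteq> topspace X" by blast
    fix L x assume "L \<notin> \<I> \<and> x ` L \<subseteq> ?P"
    then have L: "L \<notin> \<I>" "x ` L \<subseteq> ?P" by blast+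
    from L(2) have "(\<lambda>n. f (x n)) ` L \<subseteq> K" by auto
    then obtain N y where N: "N \<subseteq> L" "N \<notin> \<I>" "I_limitin \<I> Y N (\<lambda>n. f (x n)) y"
      using K(2) L unfolding I_compactin_iff[OF I'] by meson
    obtain B where B: "B \<subseteq> N" "B \<notin> \<I>" "\<And>C. C \<subseteq> B \<Longrightarrow> C \<in> \<I> \<longleftrightarrow> finite C"
      using shrinking_C_obtain[OF I C N(2)] by blast
    have y: "I_limitin \<I> Y B (\<lambda>n. f (x n)) y" using I_limitin_subset[OF I' N(3) B(1)] .
    have xB: "x ` B \<subseteq> ?P" using L(2) N(1) B(1) by blast
    have "\<exists>M l. M \<subseteq> B \<and> M \<notin> \<I> \<and> I_limitin \<I> X M x l"
    proof (rule ccontr)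
      assume "\<not> ?thesis"
      then have nolim: "\<not> I_limitin \<I> X M x l" if "M \<subseteq> B" "M \<notin> \<I>" for M l
        using that by meson
      have "x ` B \<subseteq> topspace X" using xB by blast
      from I_closedin_graph[OF I C US B(3) this nolim]
      have "I_closedin \<I> (prod_topology X nat_compactification) ((\<lambda>n. (x n, Some n)) ` B)" .
      then have "I_closedin \<I> (prod_topology Y nat_compactification)
          ((\<lambda>(x, z). (f x, z)) ` (\<lambda>n. (x n, Some n)) ` B)"
        using f unfolding I_proper_map_def I_closed_map_def by metis
      then have cl: "I_closedin \<I> (prod_topology Y nat_compactification) ((\<lambda>n. (f (x n), Some n)) ` B)"
        by (simp add: image_image)
      have "I_limitin \<I> nat_compactification B Some None"
        unfolding I_limitin_iff[OF I']
      proof (intro conjI allI impI)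
        fix U assume "openin nat_compactification U \<and> None \<in> U"
        then have "finite {n. Some n \<notin> U}" by (simp add: openin_nat_compactification)
        then show "{n \<in> B. Some n \<notin> U} \<in> \<I>"
          by (intro admissible_ideal_finite[OF I]) (auto elim: finite_subset[rotated])
      qed auto
      with y have "I_limitin \<I> (prod_topology Y nat_compactification) B
          (\<lambda>n. (f (x n), Some n)) (y, None)"
        by (rule I_limitin_prod_topology[OF I'])
      then have "(y, None) \<in> (\<lambda>n. (f (x n), Some n)) ` B"
        by (rule I_closedin_limit[OF I1 cl B(2) order_refl])
      then show False by auto
    qed
    then obtain M l where M: "M \<subseteq> B" "M \<notin> \<I>" "I_limitin \<I> X M x l" by blast
    have "closedin X ?P" using closedin_continuous_map_preimage[OF P K(1)] .
    then have "openin X (topspace X - ?P)" by blast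
    \<comment> \<open>All terms lie in the closed set \<open>?P\<close>, so a limit outside would
      make the whole of \<open>M\<close> thin.\<close>
    have "l \<in> ?P"
    proof (rule ccontr)
      assume "l \<notin> ?P"
      then have "{n \<in> M. x n \<notin> topspace X - ?P} \<in> \<I>"
        using I_limitinD[OF I' M(3) \<open>openin X (topspace X - ?P)\<close>] M(3)
        by (auto simp: I_limitin_def)
      moreover have "{n \<in> M. x n \<notin> topspace X - ?P} = M" using M(1) xB by auto
      ultimately show False using M(2) by simp
    qed
    then show "\<exists>M\<subseteq>L. M \<notin> \<I> \<and> (\<exists>l\<in>?P. I_limitin \<I> X M x l)"
      using M(2,3) order_trans[OF M(1) order_trans[OF B(1) N(1)]] by meson
  qed
qed

theorem theorem2p20:
  fixes \<I> :: "nat set set" and X :: "'a topology" and Y :: "'b topology" and f :: "'a \<Rightarrow> 'b"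
  assumes "admissible_ideal \<I>" and "shrinking_C \<I>"
    and "I_sequential \<I> X" and "I_US \<I> X"
    and "I_sequential \<I> Y" and "I_US \<I> Y"
    and "t1_space X"
    and "continuous_map X Y f"
    and "infinite (UNIV :: 'z set)"
  shows "continuous_map (I_compactification \<I> X) (I_compactification \<I> Y) (map_option f) \<longleftrightarrow>
         I_proper_map TYPE('z) \<I> X Y f"
proof -
  note I1 = admissible_ideal_imp_nontrivial[OF assms(1)]
  note I' = nontrivial_ideal_imp_nat_ideal[OF I1]
  show ?thesis
    unfolding continuous_map_I_compactification_iff[OF I' assms(8)]
  proof (intro iffI allI impI)
    assume *: "\<forall>K. closedin Y K \<and> I_compactin \<I> Y K \<longrightarrow> I_compactin \<I> X {x \<in> topspace X. f x \<in> K}"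
    \<comment> \<open>This direction yields closedness for test spaces on any type, so
      \<open>'z\<close> is reached directly.\<close>
    show "I_proper_map TYPE('z) \<I> X Y f"
      by (rule I_proper_map_if_I_compact_preimages[OF assms(1,2,5,6,8)])
        (rule *[rule_format, OF conjI])
  next
    fix K assume "I_proper_map TYPE('z) \<I> X Y f" and K: "closedin Y K \<and> I_compactin \<I> Y K"
    \<comment> \<open>Since \<open>'z\<close> is infinite, properness carries over to
      \<open>nat option\<close>, where the test space lives.\<close>
    from I_proper_map_transfer[OF I1 assms(9) this(1)]
    have f: "I_proper_map TYPE(nat option) \<I> X Y f" .
    show "I_compactin \<I> X {x \<in> topspace X. f x \<in> K}"
      by (rule I_compact_preimage_if_I_proper_map[OF assms(1,2,4) f
            conjunct1[OF K] conjunct2[OF K] assms(8)])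
  qed
qed

end
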